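(* Let $K$ be a positive, nontrivial, additively cancellative semiring. Then the axiomatization $\mathcal A_{FD+UMI+UMDE}:=\mathcal A_{FD}\cup\mathcal A_{UMI}\cup\mathcal A_{UMDE}\cup\mathcal A_{UMI\&UMDE}\cup\mathcal A_{CYCLE\text{-}UMDE}$ is sound and complete for the implication problem for FDs+UMIs+UMDEs over $K$: for every finite set of variables $D$ and every finite set $\Sigma\cup\{\tau\}$ of atoms over $D$, each of which is a functional dependency atom, a unary marginal identity atom or a unary marginal distribution equivalence atom, $\Sigma\vdash_{\mathcal A_{FD+UMI+UMDE}}\tau$ iff $\Sigma\models_K\tau$.
   Context: Semirings $(K,+,\times,0,1)$: $(K,+,0)$ commutative monoid, $(K,\times,1)$ monoid, two-sided distributivity, $0\times a=a\times 0=0$. Positive: $a+b=0\Rightarrow a=b=0$ and $a\times b=0\Rightarrow a=0$ or $b=0$. Additively cancellative: $a+b=a+c\Rightarrow b=c$. $K$-teams: $D$ finite set of variables, $A$ finite set of values, $X$ finite set of assignments $s:D\to A$, $\mathbb X:X\to K$. $\mathrm{Supp}(\mathbb X)=\{s:\mathbb X(s)\ne0\}$; for a tuple of variables $\bar x$ and $\bar a\in A^{|\bar x|}$, $|\mathbb X_{\bar x=\bar a}|=\sum_{s\in X,\,s(\bar x)=\bar a}\mathbb X(s)$ (empty sum $0$), $X(\bar x)=\{\bar a:|\mathbb X_{\bar x=\bar a}|\ne0\}$. $\mathrm{Var}(\bar x)$: set of variables of $\bar x$. Atoms: FD $=\!(\bar x,\bar y)$ for tuples $\bar x,\bar y$ ($\bar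 x$ possibly empty, written $=\!(\bar y)$): $\mathbb X\models$ iff for all $s,s'\in\mathrm{Supp}(\mathbb X)$, $s(\bar x)=s'(\bar x)\Rightarrow s(\bar y)=s'(\bar y)$. UMI $x\approx y$ ($x,y$ single variables): $|\mathbb X_{x=a}|=|\mathbb X_{y=a}|$ for all $a\in A$. UMDE $x\approx^*y$: the multisets $\{\{|\mathbb X_{x=a}|:a\in X(x)\}\}$ and $\{\{|\mathbb X_{y=a}|:a\in X(y)\}\}$ are equal. $\Sigma\models_K\tau$: every $K$-team over $D$ satisfying all of $\Sigma$ satisfies $\tau$. Deduction: $\Sigma\vdash_{\mathcal A}\sigma$ iff there is a sequence $\tau_1,\dots,\tau_n=\sigma$ with each $\tau_i\in\Sigma$ or $\tau_i\in\Gamma$ for an instance $\Lambda\vdash\Gamma$ of an axiom of $\mathcal A$ with $\Lambda\subseteq\Sigma\cup\{\tau_1,\dots,\tau_{i-1}\}$. Axioms. $\mathcal A_{FD}$: $\emptyset\vdash=\!(\bar x,\bar x')$ whenever $\mathrm{Var}(\bar x')\subseteq\mathrm{Var}(\bar x)$; $\{=\!(\bar x,\bar y),=\!(\bar y,\bar z)\}\vdash=\!(\bar x,\bar z)$; $=\!(\bar x,\bar y)\vdash=\!(\bar x\bar z,\bar y\bar z)$. $\mathcal A_{UMI}$ (single variables): $\emptyset\vdash x\approx x$; $x\approx y\vdash y\approx x$; $\{x\approx y,y\approx z\}\vdash x\approx z$. $\mathcal A_{UMDE}$: $\emptyset\vdash x\approx^*x$; $x\approx^*y\vdash y\approx^*x$;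 $\{x\approx^*y,y\approx^*z\}\vdash x\approx^*z$. $\mathcal A_{UMI\&UMDE}$: $x\approx y\vdash x\approx^*y$. For odd $k$, $S_k(i)=i+1$ ($0\le i\le k-1$), $S_k(k)=0$; $k$-CYCLE-UMDE: $\{=\!(x_i,x_{S_k(i)}):0\le i\le k-1,i\text{ even}\}\cup\{x_i\approx^*x_{S_k(i)}:1\le i\le k,i\text{ odd}\}\vdash\{=\!(x_{S_k(i)},x_i):0\le i\le k-1, i\text{ even}\}\cup\{x_i\approx^*x_{S_k(i)}:0\le i\le k-1,i\text{ even}\}$ (single variables $x_0,\dots,x_k$); $\mathcal A_{CYCLE\text{-}UMDE}$ is the set of these rules for all odd $k$. *)

theory Defs
  imports Main "HOL-Library.FuncSet" "HOL-Library.Multiset"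
begin

text \<open>
  A semiring K is a type of class \<^class>\<open>semiring_1\<close>: a not necessarily commutative semiring in which
  0 is absorbing and 0 differs from 1 (nontriviality).  A K-team over the finite set of variables
  \<open>D\<close> with finite set of values \<open>A\<close> is a set \<open>X\<close> of assignments together with a weight
  function \<open>W\<close>, of which only the values on \<open>X\<close> matter.
\<close>

definition assignments_over :: "'v set \<Rightarrow> 'a set \<Rightarrow> ('v \<Rightarrow> 'a) set \<Rightarrow> bool" where
  "assignments_over D A X \<longleftrightarrow> finite D \<and> finite A \<and> finite X \<and> X \<subseteq> D \<rightarrow>\<^sub>E A"

definition Supp :: "('v \<Rightarrow> 'a) set \<Rightarrow> (('v \<Rightarrow> 'a) \<Rightarrow> 'k::semiring_1) \<Rightarrow> ('v \<Rightarrow> 'a) set" where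
  "Supp X W = {s \<in> X. W s \<noteq> 0}"

definition marg ::
    "('v \<Rightarrow> 'a) set \<Rightarrow> (('v \<Rightarrow> 'a) \<Rightarrow> 'k::semiring_1) \<Rightarrow> 'v list \<Rightarrow> 'a list \<Rightarrow> 'k" where
  "marg X W xs as = (\<Sum>s \<in> {s \<in> X. map s xs = as}. W s)"

definition marg_vals ::
    "'a set \<Rightarrow> ('v \<Rightarrow> 'a) set \<Rightarrow> (('v \<Rightarrow> 'a) \<Rightarrow> 'k::semiring_1) \<Rightarrow> 'v list \<Rightarrow> 'a list set" where
  "marg_vals A X W xs = {as. length as = length xs \<and> set as \<subseteq> A \<and> marg X W xs as \<noteq> 0}"

datatype 'v atom =
    FD "'v list" "'v list"
  | UMI 'v 'v
  | UMDE 'v 'v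

fun atom_vars :: "'v atom \<Rightarrow> 'v set" where
  "atom_vars (FD xs ys) = set xs \<union> set ys"
| "atom_vars (UMI x y) = {x, y}"
| "atom_vars (UMDE x y) = {x, y}"

definition atoms_over :: "'v set \<Rightarrow> 'v atom set" where
  "atoms_over D = {\<sigma>. atom_vars \<sigma> \<subseteq> D}"

fun sat ::
    "'a set \<Rightarrow> ('v \<Rightarrow> 'a) set \<Rightarrow> (('v \<Rightarrow> 'a) \<Rightarrow> 'k::semiring_1) \<Rightarrow> 'v atom \<Rightarrow> bool" where
  "sat A X W (FD xs ys) \<longleftrightarrow>
     (\<forall>s \<in> Supp X W. \<forall>s' \<in> Supp X W. map s xs = map s' xs \<longrightarrow> map s ys = map s' ys)"
| "sat A X W (UMI x y) \<longleftrightarrow> (\<forall>a \<in> A. marg X W [x] [a] = marg X W [y] [a])"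
| "sat A X W (UMDE x y) \<longleftrightarrow>
     image_mset (marg X W [x]) (mset_set (marg_vals A X W [x])) =
     image_mset (marg X W [y]) (mset_set (marg_vals A X W [y]))"

text \<open>
  The finite value sets range over the finite subsets of a type \<open>'a\<close>; as long as \<open>'a\<close> is infinite,
  these are all finite sets up to renaming of values.
\<close>

definition entails ::
    "'a itself \<Rightarrow> 'k::semiring_1 itself \<Rightarrow> 'v set \<Rightarrow> 'v atom set \<Rightarrow> 'v atom \<Rightarrow> bool" where
  "entails TA TK D \<Sigma> \<tau> \<longleftrightarrow>
     (\<forall>(A :: 'a set) X (W :: ('v \<Rightarrow> 'a) \<Rightarrow> 'k).
        assignments_over D A X \<longrightarrow> (\<forall>\<sigma> \<in> \<Sigma>. sat A X W \<sigma>) \<longrightarrow> sat A X W \<tau>)"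

text \<open>
  An axiomatization is the set of all instances \<open>(\<Lambda>, \<Gamma>)\<close> of its rules (premises, conclusions).
  The type \<open>'v\<close> may contain variables outside \<open>D\<close>; deductions use only atoms over \<open>D\<close>.
\<close>

type_synonym 'v axioms = "('v atom set \<times> 'v atom set) set"

definition derives :: "'v set \<Rightarrow> 'v axioms \<Rightarrow> 'v atom set \<Rightarrow> 'v atom \<Rightarrow> bool" where
  "derives D \<A> \<Sigma> \<sigma> \<longleftrightarrow>
     (\<exists>\<tau>s. \<tau>s \<noteq> [] \<and> last \<tau>s = \<sigma> \<and> set \<tau>s \<subseteq> atoms_over D \<and>
        (\<forall>i < length \<tau>s. \<tau>s ! i \<in> \<Sigma> \<or>
           (\<exists>(\<Lambda>, \<Gamma>) \<in> \<A>. \<tau>s ! i \<in> \<Gamma> \<and> \<Lambda> \<subseteq> \<Sigma> \<union> set (take i \<tau>s))))"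

definition A_FD :: "'v axioms" where
  "A_FD =
     {({}, {FD xs xs'}) | xs xs'. set xs' \<subseteq> set xs} \<union>
     {({FD xs ys, FD ys zs}, {FD xs zs}) | xs ys zs. True} \<union>
     {({FD xs ys}, {FD (xs @ zs) (ys @ zs)}) | xs ys zs. True}"

definition A_UMI :: "'v axioms" where
  "A_UMI =
     {({}, {UMI x x}) | x. True} \<union>
     {({UMI x y}, {UMI y x}) | x y. True} \<union>
     {({UMI x y, UMI y z}, {UMI x z}) | x y z. True}"

definition A_UMDE :: "'v axioms" where
  "A_UMDE =
     {({}, {UMDE x x}) | x. True} \<union>
     {({UMDE x y}, {UMDE y x}) | x y. True} \<union>
     {({UMDE x y, UMDE y z}, {UMDE x z}) | x y z. True}"

definition A_UMI_UMDE :: "'v axioms" where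
  "A_UMI_UMDE = {({UMI x y}, {UMDE x y}) | x y. True}"

definition cycle_succ :: "nat \<Rightarrow> nat \<Rightarrow> nat" where
  "cycle_succ k i = (if i = k then 0 else i + 1)"

text \<open>The variables \<open>x 0, \<dots>, x k\<close> of an instance of a cycle rule need not be distinct.\<close>

definition cycle_prems :: "nat \<Rightarrow> (nat \<Rightarrow> 'v) \<Rightarrow> 'v atom set" where
  "cycle_prems k x =
     {FD [x i] [x (cycle_succ k i)] | i. i \<le> k - 1 \<and> even i} \<union>
     {UMDE (x i) (x (cycle_succ k i)) | i. 1 \<le> i \<and> i \<le> k \<and> odd i}"

definition cycle_concls :: "nat \<Rightarrow> (nat \<Rightarrow> 'v) \<Rightarrow> 'v atom set" where
  "cycle_concls k x =
     {FD [x (cycle_succ k i)] [x i] | i. i \<le> k - 1 \<and> even i} \<union>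
     {UMDE (x i) (x (cycle_succ k i)) | i. i \<le> k - 1 \<and> even i}"

definition A_CYCLE_UMDE :: "'v axioms" where
  "A_CYCLE_UMDE = {(cycle_prems k x, cycle_concls k x) | k x. odd k}"

definition A_FD_UMI_UMDE :: "'v axioms" where
  "A_FD_UMI_UMDE = A_FD \<union> A_UMI \<union> A_UMDE \<union> A_UMI_UMDE \<union> A_CYCLE_UMDE"

end

theory Submission
  imports Defs "HOL-Library.Nat_Bijection"
begin

text \<open>
  Soundness of the cycle rules: along the cycle the number of values of the variables cannot
  increase, so it is constant, and every functional dependency of the cycle is a bijection of values
  which preserves the marginals.

  Completeness: positivity and cancellation embed the natural numbers into K, so integer weights
  suffice. Given a list \<open>C\<^sub>1, \<dots>, C\<^sub>n\<close> of sets of variables closed under the derivable functional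
  dependencies, take independent fair bits \<open>b\<^sub>1, \<dots>, b\<^sub>n\<close> and let the value of \<open>x\<close> be the tuple of those
  \<open>b\<^sub>i\<close> with \<open>x \<notin> C\<^sub>i\<close>. All derivable functional dependencies hold, and every marginal is uniform,
  hence determined by the number of \<open>i\<close> with \<open>x \<in> C\<^sub>i\<close>. Since the cycle rules make the graph of unary
  functional dependencies between UMDE classes acyclic, the list can be chosen such that these
  numbers agree exactly within UMDE classes, and such that it contains the closure of the left-hand
  side of a given underivable functional dependency, which then fails. Renaming the values
  separately for each UMI class takes care of marginal identity.
\<close>

section \<open>Soundness\<close>

lemma sum_eq_0_iff_positive:
  fixes f :: "'b \<Rightarrow> 'k::semiring_1"
  assumes positive_add: "\<And>a b :: 'k. a + b = 0 \<Longrightarrow> a = 0 \<and> b = 0" and "finite S"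
  shows "sum f S = 0 \<longleftrightarrow> (\<forall>s\<in>S. f s = 0)"
  using \<open>finite S\<close> by (induction S rule: finite_induct) (auto dest: positive_add)

text \<open>By positivity nonzero weights never add up to 0, so a marginal vanishes only if the
  support misses its fibre.\<close>

lemma marg_vals_singleton:
  fixes W :: "('v \<Rightarrow> 'a) \<Rightarrow> 'k::semiring_1"
  assumes positive_add: "\<And>a b :: 'k. a + b = 0 \<Longrightarrow> a = 0 \<and> b = 0"
    and over: "assignments_over D A X" and "x \<in> D"
  shows "marg_vals A X W [x] = (\<lambda>s. [s x]) ` Supp X W"
proof -
  have mem: "s x \<in> A" if "s \<in> X" for s
    using over that \<open>x \<in> D\<close> by (auto simp: assignments_over_def)
  have marg: "marg X W [x] as = 0 \<longleftrightarrow> (\<forall>s\<in>X. [s x] = as \<longrightarrow> W s = 0)" for as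
    using over sum_eq_0_iff_positive[OF positive_add, of "{s \<in> X. map s [x] = as}" W]
    by (auto simp: marg_def assignments_over_def)
  show ?thesis
    unfolding marg_vals_def marg using mem by (auto simp: Supp_def image_iff)
qed

text \<open>The multiset of a UMDE atom has one entry per value with nonzero marginal, so its size
  counts the values taken on the support.\<close>

lemma card_range_UMDE:
  fixes W :: "('v \<Rightarrow> 'a) \<Rightarrow> 'k::semiring_1"
  assumes positive_add: "\<And>a b :: 'k. a + b = 0 \<Longrightarrow> a = 0 \<and> b = 0"
    and over: "assignments_over D A X" and "x \<in> D" "y \<in> D" and "sat A X W (UMDE x y)"
  shows "card ((\<lambda>s. s x) ` Supp X W) = card ((\<lambda>s. s y) ` Supp X W)"
proof -
  have card: "card (marg_vals A X W [z]) = card ((\<lambda>s. s z) ` Supp X W)" if "z \<in> D" for z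
  proof -
    have "marg_vals A X W [z] = (\<lambda>a. [a]) ` (\<lambda>s. s z) ` Supp X W"
      using marg_vals_singleton[OF positive_add over that, of W] by (simp add: image_image)
    then show ?thesis by (simp add: card_image inj_on_def)
  qed
  have "size (image_mset (marg X W [x]) (mset_set (marg_vals A X W [x]))) =
        size (image_mset (marg X W [y]) (mset_set (marg_vals A X W [y])))"
    using assms(5) by simp
  then show ?thesis using card assms(3,4) by simp
qed

lemma FD_function:
  assumes "sat A X W (FD [x] [y])"
  obtains g where "\<And>s. s \<in> Supp X W \<Longrightarrow> s y = g (s x)"
proof
  fix s assume s: "s \<in> Supp X W"
  let ?t = "SOME t. t \<in> Supp X W \<and> t x = s x"
  have "?t \<in> Supp X W \<and> ?t x = s x"
    by (rule someI[of _ s]) (use s in auto)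
  then show "s y = (\<lambda>a. (SOME t. t \<in> Supp X W \<and> t x = a) y) (s x)"
    using assms s by auto
qed

lemma card_range_FD:
  assumes "finite X" and "sat A X W (FD [x] [y])"
  shows "card ((\<lambda>s. s y) ` Supp X W) \<le> card ((\<lambda>s. s x) ` Supp X W)"
proof -
  obtain g where "\<And>s. s \<in> Supp X W \<Longrightarrow> s y = g (s x)"
    using FD_function[OF assms(2)] by blast
  then have "(\<lambda>s. s y) ` Supp X W = g ` (\<lambda>s. s x) ` Supp X W"
    by (auto simp: image_image)
  moreover have "finite (Supp X W)" using assms(1) by (simp add: Supp_def)
  ultimately show ?thesis by (simp add: card_image_le)
qed

text \<open>A map of a finite set onto one of the same size is injective, hence can be
  inverted.\<close>

lemma FD_reverse_of_card_eq:
  assumes "finite X" and fd: "sat A X W (FD [x] [y])"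
    and card: "card ((\<lambda>s. s y) ` Supp X W) = card ((\<lambda>s. s x) ` Supp X W)"
  shows "sat A X W (FD [y] [x])"
proof -
  have fin: "finite (Supp X W)" using assms(1) by (simp add: Supp_def)
  obtain g where g: "\<And>s. s \<in> Supp X W \<Longrightarrow> s y = g (s x)"
    using FD_function[OF fd] by blast
  then have "(\<lambda>s. s y) ` Supp X W = g ` (\<lambda>s. s x) ` Supp X W"
    by (auto simp: image_image)
  then have "inj_on g ((\<lambda>s. s x) ` Supp X W)"
    using card fin by (intro eq_card_imp_inj_on) auto
  then show ?thesis using g by (auto simp: inj_on_def)
qed

text \<open>Dependencies both ways make \<open>x\<close> and \<open>y\<close> split the support into
  the same fibres, up to a bijective renaming of values.\<close>

lemma UMDE_of_FD_both:
  fixes W :: "('v \<Rightarrow> 'a) \<Rightarrow> 'k::semiring_1"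
  assumes positive_add: "\<And>a b :: 'k. a + b = 0 \<Longrightarrow> a = 0 \<and> b = 0"
    and over: "assignments_over D A X" and "x \<in> D" "y \<in> D"
    and xy: "sat A X W (FD [x] [y])" and yx: "sat A X W (FD [y] [x])"
  shows "sat A X W (UMDE x y)"
proof -
  let ?S = "Supp X W"
  have fin: "finite X" using over by (simp add: assignments_over_def)
  obtain g where "\<And>s. s \<in> ?S \<Longrightarrow> s y = g (s x)"
    using FD_function[OF xy] by blast
  then have h: "map g [s x] = [s y]" if "s \<in> ?S" for s using that by simp
  \<comment> \<open>Marginals are indexed by lists of values, so the bijection of values is lifted
    to singleton lists.\<close>
  define h where "h = map g"
  note h = h[folded h_def]
  have vals: "marg_vals A X W [z] = (\<lambda>s. [s z]) ` ?S" if "z \<in> D" for z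
    by (rule marg_vals_singleton[OF positive_add over that])
  have "inj_on h (marg_vals A X W [x])"
    using h yx unfolding vals[OF \<open>x \<in> D\<close>] by (auto simp: inj_on_def)
  then have "mset_set (marg_vals A X W [y]) = image_mset h (mset_set (marg_vals A X W [x]))"
    using h by (subst image_mset_mset_set)
      (auto simp: vals \<open>x \<in> D\<close> \<open>y \<in> D\<close> image_image intro!: arg_cong[where f = mset_set])
  moreover have "marg X W [y] (h as) = marg X W [x] as" if as: "as \<in> marg_vals A X W [x]" for as
  proof -
    obtain s where s: "s \<in> ?S" "as = [s x]" using as unfolding vals[OF \<open>x \<in> D\<close>] by auto
    \<comment> \<open>The two fibres can differ only outside the support, where weights
      vanish.\<close>
    have "W t = 0" if "t \<in> X" "(t y = s y) \<noteq> (t x = s x)" for t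
      using that xy yx s(1) by (auto simp: Supp_def)
    then show ?thesis
      unfolding marg_def using h[OF s(1)] s fin
      by (intro sum.mono_neutral_cong) auto
  qed
  moreover have "finite (marg_vals A X W [x])"
    using fin vals[OF \<open>x \<in> D\<close>] by (simp add: Supp_def)
  ultimately show ?thesis
    by (auto simp: multiset.map_comp o_def intro!: image_mset_cong)
qed

section \<open>Soundness of the rules and of deductions\<close>

lemma cycle_rule_sound:
  fixes W :: "('v \<Rightarrow> 'a) \<Rightarrow> 'k::semiring_1"
  assumes positive_add: "\<And>a b :: 'k. a + b = 0 \<Longrightarrow> a = 0 \<and> b = 0"
    and over: "assignments_over D A X" and "odd k"
    and D: "cycle_prems k x \<subseteq> atoms_over D"
    and sat: "\<And>\<sigma>. \<sigma> \<in> cycle_prems k x \<Longrightarrow> sat A X W \<sigma>"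
    and "\<gamma> \<in> cycle_concls k x"
  shows "sat A X W \<gamma>"
proof -
  have fin: "finite X" using over by (simp add: assignments_over_def)
  define c where "c i = card ((\<lambda>s. s (x i)) ` Supp X W)" for i
  have fd: "FD [x i] [x (Suc i)] \<in> cycle_prems k x" if "i < k" "even i" for i
    using that by (force simp: cycle_prems_def cycle_succ_def)
  have umde: "UMDE (x i) (x (cycle_succ k i)) \<in> cycle_prems k x" if "i \<le> k" "odd i" for i
    using that by (force simp: cycle_prems_def elim: oddE)
  \<comment> \<open>Every index occurs in a premise: odd ones in a UMDE, even ones in an FD, since
    an even \<open>i \<le> k\<close> is less than the odd \<open>k\<close>.\<close>
  have xD: "x i \<in> D" if "i \<le> k" for i
  proof (cases "odd i")
    case True
    then show ?thesis using umde[OF that] D by (force simp: atoms_over_def)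
  next
    case False
    then have "i < k" using that \<open>odd k\<close> by (cases "i = k") auto
    then show ?thesis using fd[of i] D False by (force simp: atoms_over_def)
  qed
  have step: "c (Suc i) \<le> c i" if "i < k" for i
  proof (cases "even i")
    case True
    then show ?thesis using card_range_FD[OF fin sat[OF fd]] that by (simp add: c_def)
  next
    case False
    then have "UMDE (x i) (x (Suc i)) \<in> cycle_prems k x"
      using umde[of i] that by (simp add: cycle_succ_def)
    from card_range_UMDE[OF positive_add over _ _ sat[OF this]] xD that
    show ?thesis by (simp add: c_def)
  qed
  have mono: "c j \<le> c i" if "i \<le> j" "j \<le> k" for i j
    using that(1,2) by (induction j rule: dec_induct) (auto intro: order_trans[OF step])
  \<comment> \<open>The UMDE premise at the odd index \<open>k\<close> wraps around to
    \<open>x 0\<close> and closes the descending chain.\<close>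
  have "c k = c 0"
    using card_range_UMDE[OF positive_add over _ _ sat[OF umde[of k]]] \<open>odd k\<close> xD
    by (simp add: c_def cycle_succ_def)
  then have eq: "c (Suc i) = c i" if "i < k" for i
    using mono[of 0 i] mono[of "Suc i" k] step[OF that] that by linarith
  have concl: "sat A X W (FD [x (Suc i)] [x i]) \<and> sat A X W (UMDE (x i) (x (Suc i)))"
    if "i < k" "even i" for i
  proof -
    note fd' = sat[OF fd[OF that]]
    have "sat A X W (FD [x (Suc i)] [x i])"
      using FD_reverse_of_card_eq[OF fin fd'] eq[OF that(1)] by (simp only: c_def)
    with UMDE_of_FD_both[OF positive_add over _ _ fd' this] xD that show ?thesis by simp
  qed
  \<comment> \<open>As \<open>k\<close> is odd it is positive, so the truncated \<open>k - 1\<close>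
    really bounds \<open>i\<close> below \<open>k\<close>.\<close>
  have lt: "i < k" "cycle_succ k i = Suc i" if "i \<le> k - 1" for i
    using that \<open>odd k\<close> by (auto simp: cycle_succ_def elim: oddE)
  show ?thesis
    using \<open>\<gamma> \<in> cycle_concls k x\<close> concl lt unfolding cycle_concls_def
    by (auto simp del: sat.simps)
qed

lemma rule_sound:
  fixes W :: "('v \<Rightarrow> 'a) \<Rightarrow> 'k::semiring_1"
  assumes positive_add: "\<And>a b :: 'k. a + b = 0 \<Longrightarrow> a = 0 \<and> b = 0"
    and over: "assignments_over D A X"
    and rule: "(\<Lambda>, \<Gamma>) \<in> A_FD_UMI_UMDE" and D: "\<Lambda> \<subseteq> atoms_over D"
    and sat: "\<And>\<sigma>. \<sigma> \<in> \<Lambda> \<Longrightarrow> sat A X W \<sigma>"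
    and "\<gamma> \<in> \<Gamma>"
  shows "sat A X W \<gamma>"
proof -
  consider "(\<Lambda>, \<Gamma>) \<in> A_FD" | "(\<Lambda>, \<Gamma>) \<in> A_UMI \<union> A_UMDE" | "(\<Lambda>, \<Gamma>) \<in> A_UMI_UMDE"
    | "(\<Lambda>, \<Gamma>) \<in> A_CYCLE_UMDE"
    using rule by (auto simp: A_FD_UMI_UMDE_def)
  then show ?thesis
  proof cases
    case 1
    then consider xs ys where "\<gamma> = FD xs ys" "set ys \<subseteq> set xs"
      | xs ys zs where "\<gamma> = FD xs zs" "FD xs ys \<in> \<Lambda>" "FD ys zs \<in> \<Lambda>"
      | xs ys zs where "\<gamma> = FD (xs @ zs) (ys @ zs)" "FD xs ys \<in> \<Lambda>"
      using \<open>\<gamma> \<in> \<Gamma>\<close> unfolding A_FD_def by blast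
    then show ?thesis
    proof cases
      case 1
      then show ?thesis by auto
    next
      case 2
      from sat[OF 2(2)] sat[OF 2(3)] show ?thesis unfolding 2(1) sat.simps by blast
    next
      case 3
      from sat[OF 3(2)] show ?thesis unfolding 3(1) sat.simps by auto
    qed
  next
    case 2
    then consider x where "\<gamma> = UMI x x \<or> \<gamma> = UMDE x x"
      | x y where "\<gamma> = UMI y x" "UMI x y \<in> \<Lambda>"
      | x y z where "\<gamma> = UMI x z" "UMI x y \<in> \<Lambda>" "UMI y z \<in> \<Lambda>"
      | x y where "\<gamma> = UMDE y x" "UMDE x y \<in> \<Lambda>"
      | x y z where "\<gamma> = UMDE x z" "UMDE x y \<in> \<Lambda>" "UMDE y z \<in> \<Lambda>"
      using \<open>\<gamma> \<in> \<Gamma>\<close> unfolding A_UMI_def A_UMDE_def by blast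
    then show ?thesis
    proof cases
      case 2
      with sat[OF 2(2)] show ?thesis by simp
    next
      case 3
      with sat[OF 3(2)] sat[OF 3(3)] show ?thesis by simp
    next
      case 4
      with sat[OF 4(2)] show ?thesis by simp
    next
      case 5
      with sat[OF 5(2)] sat[OF 5(3)] show ?thesis by simp
    qed auto
  next
    case 3
    then obtain x y where xy: "\<Lambda> = {UMI x y}" "\<gamma> = UMDE x y"
      using \<open>\<gamma> \<in> \<Gamma>\<close> unfolding A_UMI_UMDE_def by auto
    then have eq: "marg X W [x] [a] = marg X W [y] [a]" if "a \<in> A" for a
      using sat[of "UMI x y"] that by simp
    have vals: "marg_vals A X W [x] = marg_vals A X W [y]"
      using eq by (auto simp: marg_vals_def length_Suc_conv)
    have "marg X W [x] as = marg X W [y] as" if "as \<in> marg_vals A X W [y]" for as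
      using that eq by (auto simp: marg_vals_def length_Suc_conv)
    \<comment> \<open>Membership in a \<open>mset_set\<close> already excludes infinite sets, for
      which that multiset is empty.\<close>
    then have "image_mset (marg X W [x]) (mset_set (marg_vals A X W [y])) =
        image_mset (marg X W [y]) (mset_set (marg_vals A X W [y]))"
      by (intro image_mset_cong) (metis elem_mset_set ex_in_conv infinite_set_mset_mset_set)
    with vals xy show ?thesis by simp
  next
    case 4
    then obtain k x where "odd k" "\<Lambda> = cycle_prems k x" "\<Gamma> = cycle_concls k x"
      by (auto simp: A_CYCLE_UMDE_def)
    then show ?thesis
      using cycle_rule_sound[OF positive_add over \<open>odd k\<close>, of x W \<gamma>] D sat \<open>\<gamma> \<in> \<Gamma>\<close> by simp
  qed
qed

lemma derives_sound:
  fixes D :: "'v set"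
  assumes positive_add: "\<And>a b :: 'k::semiring_1. a + b = 0 \<Longrightarrow> a = 0 \<and> b = 0"
    and \<Sigma>: "\<Sigma> \<subseteq> atoms_over D" and "derives D A_FD_UMI_UMDE \<Sigma> \<tau>"
  shows "entails TYPE('a) TYPE('k) D \<Sigma> \<tau>"
  unfolding entails_def
proof (intro allI impI)
  fix A :: "'a set" and X and W :: "('v \<Rightarrow> 'a) \<Rightarrow> 'k"
  assume over: "assignments_over D A X" and sat: "\<forall>\<sigma>\<in>\<Sigma>. sat A X W \<sigma>"
  obtain ts where ts: "ts \<noteq> []" "last ts = \<tau>" "set ts \<subseteq> atoms_over D"
    and step: "\<And>i. i < length ts \<Longrightarrow> ts ! i \<in> \<Sigma> \<or>
           (\<exists>(\<Lambda>, \<Gamma>) \<in> A_FD_UMI_UMDE. ts ! i \<in> \<Gamma> \<and> \<Lambda> \<subseteq> \<Sigma> \<union> set (take i ts))"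
    using assms(3) unfolding derives_def by blast
  have "sat A X W (ts ! i)" if "i < length ts" for i
    using that
  proof (induction i rule: less_induct)
    case (less i)
    consider "ts ! i \<in> \<Sigma>"
      | \<Lambda> \<Gamma> where "(\<Lambda>, \<Gamma>) \<in> A_FD_UMI_UMDE" "ts ! i \<in> \<Gamma>" "\<Lambda> \<subseteq> \<Sigma> \<union> set (take i ts)"
      using step[OF less.prems] by blast
    then show ?case
    proof cases
      case 1
      then show ?thesis using sat by simp
    next
      case 2
      have "sat A X W \<sigma>" if "\<sigma> \<in> \<Lambda>" for \<sigma>
      proof (cases "\<sigma> \<in> \<Sigma>")
        case False
        then have "\<sigma> \<in> set (take i ts)" using 2(3) that by auto
        then obtain j where "j < i" "\<sigma> = ts ! j"
          using less.prems by (auto simp: in_set_conv_nth)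
        then show ?thesis using less by simp
      qed (use sat in simp)
      \<comment> \<open>Soundness of a cycle rule relies on variables of \<open>D\<close>, for which
        all assignments are known to take values in \<open>A\<close>.\<close>
      moreover have "\<Lambda> \<subseteq> atoms_over D"
        using 2(3) \<Sigma> ts(3) set_take_subset[of i ts] by blast
      ultimately show ?thesis
        using rule_sound[OF positive_add over 2(1) _ _ 2(2)] by blast
    qed
  qed
  then show "sat A X W \<tau>"
    using ts(1,2) by (metis last_conv_nth diff_less length_greater_0_conv less_numeral_extra(1))
qed

section \<open>Deductive closure\<close>

text \<open>Leaves out the nonemptiness and the prescribed last entry of \<open>derives\<close>, so
  that derivations can be concatenated and \<open>[]\<close> is one.\<close>

definition derivation :: "'v set \<Rightarrow> 'v axioms \<Rightarrow> 'v atom set \<Rightarrow> 'v atom list \<Rightarrow> bool" where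
  "derivation D \<A> \<Sigma> ts \<longleftrightarrow> set ts \<subseteq> atoms_over D \<and>
     (\<forall>i < length ts. ts ! i \<in> \<Sigma> \<or>
        (\<exists>(\<Lambda>, \<Gamma>) \<in> \<A>. ts ! i \<in> \<Gamma> \<and> \<Lambda> \<subseteq> \<Sigma> \<union> set (take i ts)))"

lemma derives_iff_derivation:
  "derives D \<A> \<Sigma> \<sigma> \<longleftrightarrow> (\<exists>ts. ts \<noteq> [] \<and> last ts = \<sigma> \<and> derivation D \<A> \<Sigma> ts)"
  by (auto simp: derives_def derivation_def)

text \<open>The entries of \<open>ts\<close> only enlarge what is available to \<open>us\<close>,
  whose positions are shifted by \<open>length ts\<close>.\<close>

lemma derivation_append:
  assumes "derivation D \<A> \<Sigma> ts" "derivation D \<A> \<Sigma> us"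
  shows "derivation D \<A> \<Sigma> (ts @ us)"
  unfolding derivation_def
proof (intro conjI allI impI)
  show "set (ts @ us) \<subseteq> atoms_over D" using assms by (auto simp: derivation_def)
  fix i assume i: "i < length (ts @ us)"
  show "(ts @ us) ! i \<in> \<Sigma> \<or> (\<exists>(\<Lambda>, \<Gamma>) \<in> \<A>. (ts @ us) ! i \<in> \<Gamma> \<and> \<Lambda> \<subseteq> \<Sigma> \<union> set (take i (ts @ us)))"
  proof (cases "i < length ts")
    case True
    then show ?thesis using assms(1) by (auto simp: derivation_def nth_append)
  next
    case False
    then have "i - length ts < length us" using i by simp
    with assms(2) have "us ! (i - length ts) \<in> \<Sigma> \<or> (\<exists>(\<Lambda>, \<Gamma>) \<in> \<A>. us ! (i - length ts) \<in> \<Gamma> \<and>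
        \<Lambda> \<subseteq> \<Sigma> \<union> set (take (i - length ts) us))"
      unfolding derivation_def by blast
    then show ?thesis using False by (auto simp: nth_append)
  qed
qed

lemma derivation_snoc:
  assumes "derivation D \<A> \<Sigma> ts" "\<sigma> \<in> atoms_over D"
    and "\<sigma> \<in> \<Sigma> \<or> (\<exists>(\<Lambda>, \<Gamma>) \<in> \<A>. \<sigma> \<in> \<Gamma> \<and> \<Lambda> \<subseteq> \<Sigma> \<union> set ts)"
  shows "derivation D \<A> \<Sigma> (ts @ [\<sigma>])"
  using assms by (auto simp: derivation_def nth_append less_Suc_eq)

lemma derives_over: "derives D \<A> \<Sigma> \<sigma> \<Longrightarrow> \<sigma> \<in> atoms_over D"
  by (auto simp: derives_def)

text \<open>Derivations of the finitely many premises are concatenated, after which the conclusion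
  can be appended.\<close>

lemma derives_rule:
  assumes "(\<Lambda>, \<Gamma>) \<in> \<A>" "finite \<Lambda>" "\<And>\<sigma>. \<sigma> \<in> \<Lambda> \<Longrightarrow> derives D \<A> \<Sigma> \<sigma>"
    and "\<gamma> \<in> \<Gamma>" "\<gamma> \<in> atoms_over D"
  shows "derives D \<A> \<Sigma> \<gamma>"
proof -
  have "\<exists>ts. derivation D \<A> \<Sigma> ts \<and> \<Lambda> \<subseteq> set ts"
    using assms(2,3)
  proof (induction \<Lambda> rule: finite_induct)
    case empty
    then show ?case by (intro exI[of _ "[]"]) (simp add: derivation_def)
  next
    case (insert \<sigma> \<Lambda>)
    then obtain ts where "derivation D \<A> \<Sigma> ts" "\<Lambda> \<subseteq> set ts" by auto
    moreover obtain us where "us \<noteq> []" "last us = \<sigma>" "derivation D \<A> \<Sigma> us"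
      using insert.prems[of \<sigma>] by (auto simp: derives_iff_derivation)
    ultimately show ?case
      by (intro exI[of _ "ts @ us"]) (auto intro: derivation_append)
  qed
  then obtain ts where "derivation D \<A> \<Sigma> ts" "\<Lambda> \<subseteq> set ts" by blast
  then have "derivation D \<A> \<Sigma> (ts @ [\<gamma>])"
    using assms(1,4,5) by (intro derivation_snoc) auto
  then show ?thesis unfolding derives_iff_derivation by (intro exI[of _ "ts @ [\<gamma>]"]) simp
qed

section \<open>Derived rules for the three kinds of atoms\<close>

locale dependencies =
  fixes D :: "'v set" and \<Sigma> :: "'v atom set"
  assumes finite_D: "finite D" and \<Sigma>_over: "\<Sigma> \<subseteq> atoms_over D"
begin

abbreviation derivable :: "'v atom \<Rightarrow> bool" ("\<turnstile> _" [50] 50) where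
  "\<turnstile> \<sigma> \<equiv> derives D A_FD_UMI_UMDE \<Sigma> \<sigma>"

lemma derivable_premise: "\<sigma> \<in> \<Sigma> \<Longrightarrow> \<turnstile> \<sigma>"
  unfolding derives_iff_derivation using \<Sigma>_over
  by (intro exI[of _ "[\<sigma>]"]) (auto simp: derivation_def)

lemma FD_over: "\<turnstile> FD xs ys \<Longrightarrow> set xs \<subseteq> D \<and> set ys \<subseteq> D"
  and UMI_over: "\<turnstile> UMI x y \<Longrightarrow> x \<in> D \<and> y \<in> D"
  and UMDE_over: "\<turnstile> UMDE x y \<Longrightarrow> x \<in> D \<and> y \<in> D"
  by (auto dest!: derives_over simp: atoms_over_def)

lemma FD_refl:
  assumes "set ys \<subseteq> set xs" "set xs \<subseteq> D" shows "\<turnstile> FD xs ys"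
  by (rule derives_rule[of "{}" "{FD xs ys}"])
    (use assms in \<open>auto simp: A_FD_UMI_UMDE_def A_FD_def atoms_over_def\<close>)

lemma FD_trans:
  assumes "\<turnstile> FD xs ys" "\<turnstile> FD ys zs" shows "\<turnstile> FD xs zs"
  by (rule derives_rule[of "{FD xs ys, FD ys zs}" "{FD xs zs}"])
    (use assms FD_over[OF assms(1)] FD_over[OF assms(2)] in
      \<open>auto simp: A_FD_UMI_UMDE_def A_FD_def atoms_over_def\<close>)

lemma FD_augment:
  assumes "\<turnstile> FD xs ys" "set zs \<subseteq> D" shows "\<turnstile> FD (xs @ zs) (ys @ zs)"
  by (rule derives_rule[of "{FD xs ys}" "{FD (xs @ zs) (ys @ zs)}"])
    (use assms FD_over[OF assms(1)] in \<open>auto simp: A_FD_UMI_UMDE_def A_FD_def atoms_over_def\<close>)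

text \<open>Augmentation appends only on the right, so reflexivity duplicates and swaps:
  \<open>xs\<close>, \<open>xs @ xs\<close>, \<open>ys @ xs\<close>, \<open>xs @ ys\<close>,
  \<open>z # ys\<close> is a chain of dependencies.\<close>

lemma FD_Cons:
  assumes "\<turnstile> FD xs [z]" "\<turnstile> FD xs ys" shows "\<turnstile> FD xs (z # ys)"
proof -
  note D = FD_over[OF assms(1)] FD_over[OF assms(2)]
  have "\<turnstile> FD xs (xs @ xs)" "\<turnstile> FD (ys @ xs) (xs @ ys)" using D by (auto intro!: FD_refl)
  moreover have "\<turnstile> FD (xs @ xs) (ys @ xs)" using FD_augment assms D by blast
  moreover have "\<turnstile> FD (xs @ ys) (z # ys)" using FD_augment[OF assms(1), of ys] D by simp
  ultimately show ?thesis by (blast intro: FD_trans)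
qed

lemma UMI_refl: "x \<in> D \<Longrightarrow> \<turnstile> UMI x x"
  by (rule derives_rule[of "{}" "{UMI x x}"])
    (auto simp: A_FD_UMI_UMDE_def A_UMI_def atoms_over_def)

lemma UMI_sym: "\<turnstile> UMI x y \<Longrightarrow> \<turnstile> UMI y x"
  by (rule derives_rule[of "{UMI x y}" "{UMI y x}"])
    (auto simp: A_FD_UMI_UMDE_def A_UMI_def atoms_over_def dest: derives_over)

lemma UMI_trans: "\<turnstile> UMI x y \<Longrightarrow> \<turnstile> UMI y z \<Longrightarrow> \<turnstile> UMI x z"
  by (rule derives_rule[of "{UMI x y, UMI y z}" "{UMI x z}"])
    (auto simp: A_FD_UMI_UMDE_def A_UMI_def atoms_over_def dest: derives_over)

lemma UMDE_refl: "x \<in> D \<Longrightarrow> \<turnstile> UMDE x x"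
  by (rule derives_rule[of "{}" "{UMDE x x}"])
    (auto simp: A_FD_UMI_UMDE_def A_UMDE_def atoms_over_def)

lemma UMDE_sym: "\<turnstile> UMDE x y \<Longrightarrow> \<turnstile> UMDE y x"
  by (rule derives_rule[of "{UMDE x y}" "{UMDE y x}"])
    (auto simp: A_FD_UMI_UMDE_def A_UMDE_def atoms_over_def dest: derives_over)

lemma UMDE_trans: "\<turnstile> UMDE x y \<Longrightarrow> \<turnstile> UMDE y z \<Longrightarrow> \<turnstile> UMDE x z"
  by (rule derives_rule[of "{UMDE x y, UMDE y z}" "{UMDE x z}"])
    (auto simp: A_FD_UMI_UMDE_def A_UMDE_def atoms_over_def dest: derives_over)

lemma UMDE_of_UMI: "\<turnstile> UMI x y \<Longrightarrow> \<turnstile> UMDE x y"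
  by (rule derives_rule[of "{UMI x y}" "{UMDE x y}"])
    (auto simp: A_FD_UMI_UMDE_def A_UMI_UMDE_def atoms_over_def dest: derives_over)

section \<open>Cycles in the graph along whose edges value counts cannot grow\<close>

definition edges :: "('v \<times> 'v) set" where
  "edges = {(x, y). \<turnstile> FD [x] [y] \<or> \<turnstile> UMDE x y}"

lemma edges_over: "(x, y) \<in> edges \<Longrightarrow> x \<in> D \<and> y \<in> D"
  by (auto simp: edges_def dest: FD_over UMDE_over)

text \<open>Reflexive steps pad an arbitrary path to one that alternates as in the cycle rules.\<close>

lemma alternating_path:
  assumes "(y, z) \<in> edges\<^sup>*"
  shows "\<exists>k p. odd k \<and> p (Suc 0) = y \<and> p k = z \<and>
    (\<forall>i<k. odd i \<longrightarrow> \<turnstile> UMDE (p i) (p (Suc i))) \<and>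
    (\<forall>i<k. even i \<and> 0 < i \<longrightarrow> \<turnstile> FD [p i] [p (Suc i)])"
  using assms
proof (induction rule: rtrancl_induct)
  case base
  \<comment> \<open>Indices start at 1: \<open>p 0\<close> is kept free for the left-hand side of
    the dependency that later closes the cycle.\<close>
  show ?case by (intro exI[of _ 1] exI[of _ "\<lambda>_. y"]) auto
next
  case (step z z')
  then obtain k p where p: "odd k" "p (Suc 0) = y" "p k = z"
    "\<And>i. i < k \<Longrightarrow> odd i \<Longrightarrow> \<turnstile> UMDE (p i) (p (Suc i))"
    "\<And>i. i < k \<Longrightarrow> even i \<Longrightarrow> 0 < i \<Longrightarrow> \<turnstile> FD [p i] [p (Suc i)]"
    by blast
  have D: "z \<in> D" "z' \<in> D" using edges_over[OF step(2)] by auto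
  \<comment> \<open>Each edge becomes a UMDE followed by an FD: \<open>w\<close> is \<open>z\<close>
    for an FD edge and \<open>z'\<close> for a UMDE edge.\<close>
  obtain w where w: "\<turnstile> UMDE z w" "\<turnstile> FD [w] [z']"
    using step(2) D UMDE_refl FD_refl[of "[z']" "[z']"] by (auto simp: edges_def)
  define q where "q = p(Suc k := w, Suc (Suc k) := z')"
  have "\<turnstile> UMDE (q i) (q (Suc i))" if "i < Suc (Suc k)" "odd i" for i
    using p(1,3,4) w that by (auto simp: q_def less_Suc_eq)
  moreover have "\<turnstile> FD [q i] [q (Suc i)]" if "i < Suc (Suc k)" "even i" "0 < i" for i
    using p(1,3,5) w that by (auto simp: q_def less_Suc_eq)
  moreover have "q (Suc 0) = y" using p(1,2) by (cases k) (auto simp: q_def)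
  ultimately show ?case
    using p(1) by (intro exI[of _ "Suc (Suc k)"] exI[of _ q]) (auto simp: q_def)
qed

text \<open>The dependency followed by the path back forms the premises of a cycle rule, whose
  conclusions at index 0 are the two claims.\<close>

lemma FD_on_cycle:
  assumes "\<turnstile> FD [x] [y]" "(y, x) \<in> edges\<^sup>*"
  shows "\<turnstile> FD [y] [x]" and "\<turnstile> UMDE x y"
proof -
  have D: "x \<in> D" "y \<in> D" using FD_over[OF assms(1)] by auto
  obtain k p where p: "odd k" "p (Suc 0) = y" "p k = x"
    "\<And>i. i < k \<Longrightarrow> odd i \<Longrightarrow> \<turnstile> UMDE (p i) (p (Suc i))"
    "\<And>i. i < k \<Longrightarrow> even i \<Longrightarrow> 0 < i \<Longrightarrow> \<turnstile> FD [p i] [p (Suc i)]"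
    using alternating_path[OF assms(2)] by blast
  \<comment> \<open>The free slot 0 receives \<open>x\<close>. Then index 0 carries the given FD,
    and the wrap from \<open>k\<close> to 0 is the reflexive UMDE from \<open>x\<close> to
    itself.\<close>
  define q where "q = p(0 := x)"
  have k: "k > 0" using \<open>odd k\<close> by (cases k) auto
  have rule: "(cycle_prems k q, cycle_concls k q) \<in> A_FD_UMI_UMDE"
    using \<open>odd k\<close> by (auto simp: A_FD_UMI_UMDE_def A_CYCLE_UMDE_def)
  have fin: "finite (cycle_prems k q)"
    unfolding cycle_prems_def by simp
  have prems: "\<turnstile> \<sigma>" if \<sigma>: "\<sigma> \<in> cycle_prems k q" for \<sigma>
  proof -
    have fd: "\<turnstile> FD [q i] [q (cycle_succ k i)]" if "i \<le> k - 1" "even i" for i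
      using that k p(2,5) assms(1) by (cases "i = 0") (auto simp: q_def cycle_succ_def)
    have umde: "\<turnstile> UMDE (q i) (q (cycle_succ k i))" if "1 \<le> i" "i \<le> k" "odd i" for i
      using that k p(3,4) UMDE_refl[OF D(1)] by (cases "i = k") (auto simp: q_def cycle_succ_def)
    show ?thesis using \<sigma> fd umde unfolding cycle_prems_def by blast
  qed
  have succ: "cycle_succ k 0 = Suc 0" using k by (simp add: cycle_succ_def)
  have "FD [q (cycle_succ k 0)] [q 0] \<in> cycle_concls k q"
    "UMDE (q 0) (q (cycle_succ k 0)) \<in> cycle_concls k q"
    unfolding cycle_concls_def by blast+
  then have "FD [y] [x] \<in> cycle_concls k q" "UMDE x y \<in> cycle_concls k q"
    using p(2) unfolding succ by (auto simp: q_def)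
  then show "\<turnstile> FD [y] [x]" "\<turnstile> UMDE x y"
    using derives_rule[OF rule fin prems] D by (auto simp: atoms_over_def)
qed

text \<open>Each FD step on a closed walk upgrades to a UMDE by \<open>FD_on_cycle\<close>, and the
  walk then composes by transitivity.\<close>

lemma UMDE_of_cycle:
  assumes "x \<in> D" "(x, y) \<in> edges\<^sup>*" "(y, x) \<in> edges\<^sup>*"
  shows "\<turnstile> UMDE x y"
  using assms(2,3)
proof (induction rule: rtrancl_induct)
  case base
  show ?case using UMDE_refl assms(1) .
next
  case (step y z)
  have "\<turnstile> UMDE x y" using step by (meson converse_rtrancl_into_rtrancl)
  moreover have "\<turnstile> UMDE y z"
    using step(2) FD_on_cycle(2)[of y z] rtrancl_trans[OF step(4,1)] by (auto simp: edges_def)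
  ultimately show ?case by (rule UMDE_trans)
qed

section \<open>Sets closed under derivable functional dependencies\<close>

definition fd_closed :: "'v set \<Rightarrow> bool" where
  "fd_closed C \<longleftrightarrow> (\<forall>xs ys. \<turnstile> FD xs ys \<longrightarrow> set xs \<subseteq> C \<longrightarrow> set ys \<subseteq> C)"

definition fd_closure :: "'v list \<Rightarrow> 'v set" where
  "fd_closure xs = {y. \<turnstile> FD xs [y]}"

text \<open>Reflexivity and transitivity split a right-hand side into its variables;
  \<open>FD_Cons\<close> puts them together again.\<close>

lemma FD_iff_closure:
  assumes "set xs \<subseteq> D" shows "\<turnstile> FD xs ys \<longleftrightarrow> set ys \<subseteq> fd_closure xs"
proof
  assume "\<turnstile> FD xs ys"
  then show "set ys \<subseteq> fd_closure xs"
    using FD_over[of xs ys] FD_trans[of xs ys] FD_refl[of _ ys] by (auto simp: fd_closure_def)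
next
  assume "set ys \<subseteq> fd_closure xs"
  then show "\<turnstile> FD xs ys"
    using assms by (induction ys) (auto simp: fd_closure_def intro: FD_Cons FD_refl)
qed

lemma fd_closed_closure: "set xs \<subseteq> D \<Longrightarrow> fd_closed (fd_closure xs)"
  unfolding fd_closed_def by (metis FD_iff_closure FD_trans)

section \<open>The countermodel\<close>

text \<open>A list, not a set, of sets: repeating an entry is the way to raise the count of exactly
  its elements.\<close>

definition occurrences :: "'v set list \<Rightarrow> 'v \<Rightarrow> nat" where
  "occurrences Cs x = length (filter (\<lambda>C. x \<in> C) Cs)"

lemma occurrences_append: "occurrences (Cs @ Es) x = occurrences Cs x + occurrences Es x"
  by (simp add: occurrences_def)

lemma occurrences_replicate: "occurrences (replicate n C) x = (if x \<in> C then n else 0)"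
  by (simp add: occurrences_def)

lemma occurrences_le: "occurrences Cs x \<le> length Cs"
  by (simp add: occurrences_def)

text \<open>No closed set separates two mutually dependent variables.\<close>

lemma occurrences_eq:
  assumes "\<forall>C\<in>set Cs. fd_closed C" "\<turnstile> FD [x] [y]" "\<turnstile> FD [y] [x]"
  shows "occurrences Cs x = occurrences Cs y"
proof -
  have "x \<in> C \<longleftrightarrow> y \<in> C" if "C \<in> set Cs" for C
    using assms that by (auto simp: fd_closed_def)
      (metis empty_set insert_subset list.simps(15) empty_subsetI)+
  then show ?thesis unfolding occurrences_def by (metis filter_cong)
qed

text \<open>Copies of the closure of \<open>v\<close> raise exactly the variables that
  \<open>v\<close> determines. Within \<open>U\<close> these also determine \<open>v\<close> by
  \<open>rev\<close>, so they share its count, reach \<open>N\<close> together and never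
  overshoot.\<close>

lemma level_occurrences:
  assumes U: "U \<subseteq> D" and rev: "\<And>u v. u \<in> U \<Longrightarrow> v \<in> U \<Longrightarrow> \<turnstile> FD [u] [v] \<Longrightarrow> \<turnstile> FD [v] [u]"
    and Cs: "\<forall>C\<in>set Cs. fd_closed C" "\<forall>u\<in>U. occurrences Cs u \<le> N"
    and "finite V" "V \<subseteq> U"
  shows "\<exists>Es. set Es \<subseteq> (\<lambda>u. fd_closure [u]) ` U \<and>
    (\<forall>u\<in>U. occurrences (Cs @ Es) u \<le> N) \<and> (\<forall>u\<in>V. occurrences (Cs @ Es) u = N)"
  using \<open>finite V\<close> \<open>V \<subseteq> U\<close>
proof (induction V rule: finite_induct)
  case empty
  then show ?case using Cs(2) by (intro exI[of _ "[]"]) auto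
next
  case (insert v V)
  then obtain Es where Es: "set Es \<subseteq> (\<lambda>u. fd_closure [u]) ` U"
    "\<And>u. u \<in> U \<Longrightarrow> occurrences (Cs @ Es) u \<le> N" "\<And>u. u \<in> V \<Longrightarrow> occurrences (Cs @ Es) u = N"
    by auto
  have v: "v \<in> U" "v \<in> D" using insert.prems U by auto
  have closed: "\<forall>C\<in>set (Cs @ Es). fd_closed C"
    using Cs(1) Es(1) U by (fastforce intro!: fd_closed_closure)
  define Fs where "Fs = Es @ replicate (N - occurrences (Cs @ Es) v) (fd_closure [v])"
  have Fs: "occurrences (Cs @ Fs) u = (if \<turnstile> FD [v] [u] then N else occurrences (Cs @ Es) u)"
    if "u \<in> U" for u
  proof -
    have "occurrences (Cs @ Fs) u = occurrences (Cs @ Es) u +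
        (if \<turnstile> FD [v] [u] then N - occurrences (Cs @ Es) v else 0)"
      by (simp add: Fs_def occurrences_append occurrences_replicate fd_closure_def)
    moreover have "occurrences (Cs @ Es) v = occurrences (Cs @ Es) u" if "\<turnstile> FD [v] [u]"
      using occurrences_eq[OF closed that] rev[OF v(1) \<open>u \<in> U\<close> that] by simp
    ultimately show ?thesis using Es(2)[OF v(1)] by auto
  qed
  have "\<turnstile> FD [v] [v]" using v(2) by (auto intro: FD_refl)
  then have "\<forall>u\<in>insert v V. occurrences (Cs @ Fs) u = N" "\<forall>u\<in>U. occurrences (Cs @ Fs) u \<le> N"
    using Fs Es(2,3) insert.prems by auto
  moreover have "set Fs \<subseteq> (\<lambda>u. fd_closure [u]) ` U"
    using Es(1) v(1) by (auto simp: Fs_def)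
  ultimately show ?case by blast
qed

text \<open>
  Induction on \<open>S\<close>, removing a sink class \<open>U\<close> of \<open>UMDE\<close>: closures of variables of \<open>U\<close> miss \<open>S - U\<close>,
  so adding copies of them lifts the counts on \<open>U\<close> to a fresh common value without any effect
  on \<open>S - U\<close>.
\<close>

lemma occurrences_separate_UMDE_on:
  assumes C0: "fd_closed C0"
    and "S \<subseteq> D" "\<And>x y. x \<in> S \<Longrightarrow> (y, x) \<in> edges \<Longrightarrow> y \<in> S"
  shows "\<exists>Cs. C0 \<in> set Cs \<and> (\<forall>C\<in>set Cs. fd_closed C) \<and>
    (\<forall>x\<in>S. \<forall>y\<in>S. occurrences Cs x = occurrences Cs y \<longleftrightarrow> \<turnstile> UMDE x y)"
  using assms(2,3)
proof (induction "card S" arbitrary: S rule: less_induct)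
  case less
  show ?case
  proof (cases "S = {}")
    case True
    \<comment> \<open>\<open>C0\<close> enters the list here, and later steps only append.\<close>
    then show ?thesis using C0 by (intro exI[of _ "[C0]"]) auto
  next
    case False
    have finS: "finite S" using less.prems(1) finite_D finite_subset by blast
    \<comment> \<open>Maximizing the number of ancestors finds a sink component: a variable of
      \<open>S\<close> reachable from \<open>u\<close> has all ancestors of \<open>u\<close>, hence
      by maximality no others, and so leads back to \<open>u\<close>.\<close>
    define pred where "pred x = {y \<in> D. (y, x) \<in> edges\<^sup>*}" for x
    have fin_pred: "finite (pred x)" for x using finite_D by (simp add: pred_def)
    obtain u where u: "u \<in> S" and max: "\<And>x. x \<in> S \<Longrightarrow> card (pred x) \<le> card (pred u)"
    proof -
      have "Max ((\<lambda>x. card (pred x)) ` S) \<in> (\<lambda>x. card (pred x)) ` S"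
        using finS False by (intro Max_in) auto
      then obtain v where v: "v \<in> S" "Max ((\<lambda>x. card (pred x)) ` S) = card (pred v)" by auto
      have "\<forall>x\<in>S. card (pred x) \<le> card (pred v)"
        unfolding v(2)[symmetric] using finS by auto
      then show thesis using that v(1) by blast
    qed
    have return: "(x, u) \<in> edges\<^sup>*" if "x \<in> S" "(u, x) \<in> edges\<^sup>*" for x
    proof -
      have "pred u \<subseteq> pred x" using that(2) by (auto simp: pred_def)
      then have "pred u = pred x"
        using max[OF that(1)] fin_pred by (simp add: card_seteq)
      moreover have "x \<in> pred x" using that(1) less.prems(1) by (auto simp: pred_def)
      ultimately show ?thesis by (auto simp: pred_def)
    qed
    define U where "U = {v \<in> S. \<turnstile> UMDE u v}"
    have uU: "u \<in> U" using u less.prems(1) UMDE_refl by (auto simp: U_def)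
    have UMDE_U: "\<turnstile> UMDE v w" if "v \<in> U" "w \<in> U" for v w
      using that UMDE_sym UMDE_trans unfolding U_def by blast
    \<comment> \<open>Removing \<open>U\<close> keeps closure under predecessors: an edge from
      \<open>U\<close> to \<open>x\<close> would make \<open>x\<close> reachable from
      \<open>u\<close>, so on a cycle with \<open>u\<close>, hence UMDE equivalent to it and in
      \<open>U\<close>.\<close>
    have S': "y \<in> S - U" if "x \<in> S - U" "(y, x) \<in> edges" for x y
    proof -
      have "y \<in> S" using less.prems(2) that by blast
      moreover have "y \<notin> U"
      proof
        assume "y \<in> U"
        then have "(u, y) \<in> edges" by (auto simp: U_def edges_def)
        then have "(u, x) \<in> edges\<^sup>*" using that(2) by auto
        then have "\<turnstile> UMDE u x"
          using return[of x] that(1) UMDE_of_cycle u less.prems(1) by blast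
        then show False using that(1) by (auto simp: U_def)
      qed
      ultimately show ?thesis by simp
    qed
    have "card (S - U) < card S"
      using uU finS by (intro psubset_card_mono) (auto simp: U_def)
    moreover have "S - U \<subseteq> D" using less.prems(1) by auto
    ultimately have "\<exists>Cs. C0 \<in> set Cs \<and> (\<forall>C\<in>set Cs. fd_closed C) \<and>
        (\<forall>x\<in>S - U. \<forall>y\<in>S - U. occurrences Cs x = occurrences Cs y \<longleftrightarrow> \<turnstile> UMDE x y)"
      using S' by (rule less.hyps)
    then obtain Cs where Cs: "C0 \<in> set Cs" "\<forall>C\<in>set Cs. fd_closed C"
      "\<And>x y. x \<in> S - U \<Longrightarrow> y \<in> S - U \<Longrightarrow> occurrences Cs x = occurrences Cs y \<longleftrightarrow> \<turnstile> UMDE x y"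
      by blast
    have UD: "U \<subseteq> D" using less.prems(1) by (auto simp: U_def)
    have finU: "finite U" using finS by (simp add: U_def)
    \<comment> \<open>UMDE edges lead back inside \<open>U\<close>, so every FD within
      \<open>U\<close> lies on a cycle and is reversible.\<close>
    have "\<turnstile> FD [w] [v]" if "v \<in> U" "w \<in> U" "\<turnstile> FD [v] [w]" for v w
      using FD_on_cycle(1)[OF that(3)] UMDE_U[OF that(2,1)] by (auto simp: edges_def)
    \<comment> \<open>\<open>Suc (length Cs)\<close> exceeds every count in \<open>Cs\<close>, which
      makes the common value fresh.\<close>
    moreover have "\<forall>u\<in>U. occurrences Cs u \<le> Suc (length Cs)"
      using occurrences_le[THEN le_SucI] by blast
    ultimately have "\<exists>Es. set Es \<subseteq> (\<lambda>u. fd_closure [u]) ` U \<and>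
        (\<forall>u\<in>U. occurrences (Cs @ Es) u \<le> Suc (length Cs)) \<and>
        (\<forall>u\<in>U. occurrences (Cs @ Es) u = Suc (length Cs))"
      using level_occurrences[OF UD _ Cs(2) _ finU subset_refl] by blast
    then obtain Es where Es: "set Es \<subseteq> (\<lambda>u. fd_closure [u]) ` U"
      "\<And>v. v \<in> U \<Longrightarrow> occurrences (Cs @ Es) v = Suc (length Cs)"
      by blast
    have old: "occurrences (Cs @ Es) x = occurrences Cs x" if "x \<in> S - U" for x
    proof -
      have "x \<notin> E" if "E \<in> set Es" for E
        using Es(1) that S'[OF \<open>x \<in> S - U\<close>] by (auto simp: fd_closure_def edges_def)
      then show ?thesis by (simp add: occurrences_append) (simp add: occurrences_def)
    qed
    have ne: "occurrences (Cs @ Es) x \<noteq> occurrences (Cs @ Es) v" if "x \<in> S - U" "v \<in> U" for x v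
      using old[OF that(1)] Es(2)[OF that(2)] occurrences_le[of Cs x] by linarith
    have not: "\<not> \<turnstile> UMDE x v \<and> \<not> \<turnstile> UMDE v x" if "x \<in> S - U" "v \<in> U" for x v
      using that UMDE_trans UMDE_sym unfolding U_def by blast
    have "occurrences (Cs @ Es) x = occurrences (Cs @ Es) y \<longleftrightarrow> \<turnstile> UMDE x y"
      if "x \<in> S" "y \<in> S" for x y
    proof (cases "x \<in> U"; cases "y \<in> U")
      assume "x \<in> U" "y \<in> U"
      then show ?thesis using Es(2) UMDE_U by auto
    next
      assume "x \<in> U" "y \<notin> U"
      then show ?thesis using ne[of y x] not[of y x] that by auto
    next
      assume "x \<notin> U" "y \<in> U"
      then show ?thesis using ne[of x y] not[of x y] that by auto
    next
      assume "x \<notin> U" "y \<notin> U"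
      then show ?thesis using Cs(3)[of x y] old that by auto
    qed
    moreover have "\<forall>C\<in>set (Cs @ Es). fd_closed C"
      using Cs(2) Es(1) UD by (fastforce intro!: fd_closed_closure)
    ultimately show ?thesis using Cs(1) by (intro exI[of _ "Cs @ Es"]) auto
  qed
qed

lemma occurrences_separate_UMDE:
  assumes "fd_closed C0"
  obtains Cs where "C0 \<in> set Cs" "\<And>C. C \<in> set Cs \<Longrightarrow> fd_closed C"
    "\<And>x y. x \<in> D \<Longrightarrow> y \<in> D \<Longrightarrow> occurrences Cs x = occurrences Cs y \<longleftrightarrow> \<turnstile> UMDE x y"
  using occurrences_separate_UMDE_on[OF assms subset_refl] edges_over by blast

section \<open>Marginal identity classes and the team of bit vectors\<close>

lemma UMI_classes:
  obtains c :: "'v \<Rightarrow> nat" where "\<And>x y. x \<in> D \<Longrightarrow> y \<in> D \<Longrightarrow> c x = c y \<longleftrightarrow> \<turnstile> UMI x y"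
proof -
  obtain t :: "'v \<Rightarrow> nat" where t: "inj_on t D"
    using finite_imp_inj_to_nat_seg[OF finite_D] by blast
  define r where "r x = (SOME y. \<turnstile> UMI x y)" for x
  have r: "\<turnstile> UMI x (r x)" if "x \<in> D" for x
    unfolding r_def by (rule someI[of _ x]) (rule UMI_refl[OF that])
  have "r x = r y \<longleftrightarrow> \<turnstile> UMI x y" if "x \<in> D" "y \<in> D" for x y
  proof
    assume "r x = r y"
    then show "\<turnstile> UMI x y" using r[OF that(1)] r[OF that(2)] UMI_sym UMI_trans by metis
  next
    assume "\<turnstile> UMI x y"
    \<comment> \<open>Equivalent variables satisfy the same predicate, so the choice operator picks
      the same representative.\<close>
    then have "(\<lambda>z. \<turnstile> UMI x z) = (\<lambda>z. \<turnstile> UMI y z)" using UMI_sym UMI_trans by blast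
    then show "r x = r y" by (simp add: r_def)
  qed
  moreover have "t (r x) = t (r y) \<longleftrightarrow> r x = r y" if "x \<in> D" "y \<in> D" for x y
    using t r[OF that(1)] r[OF that(2)] UMI_over by (auto simp: inj_on_def)
  ultimately show thesis by (intro that[of "\<lambda>x. t (r x)"]) simp
qed

lemma countermodel:
  assumes inj: "inj (of_nat :: nat \<Rightarrow> 'k::semiring_1)" and inf: "infinite (UNIV :: 'a set)"
    and \<tau>: "\<tau> \<in> atoms_over D" "\<not> \<turnstile> \<tau>"
  shows "\<exists>(A :: 'a set) X (W :: ('v \<Rightarrow> 'a) \<Rightarrow> 'k).
    assignments_over D A X \<and> (\<forall>\<sigma>\<in>\<Sigma>. sat A X W \<sigma>) \<and> \<not> sat A X W \<tau>"
proof -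
  \<comment> \<open>For an FD the closure of its left-hand side is put into the list in order to
    refute it; otherwise any closed set does, and \<open>UNIV\<close> is one.\<close>
  define C0 where "C0 = (case \<tau> of FD xs ys \<Rightarrow> fd_closure xs | _ \<Rightarrow> UNIV)"
  have "fd_closed C0"
    using \<tau>(1) by (cases \<tau>) (auto simp: C0_def atoms_over_def fd_closed_closure,
        auto simp: fd_closed_def)
  then obtain Cs where Cs: "C0 \<in> set Cs" "\<And>C. C \<in> set Cs \<Longrightarrow> fd_closed C"
    and occ: "\<And>x y. x \<in> D \<Longrightarrow> y \<in> D \<Longrightarrow> occurrences Cs x = occurrences Cs y \<longleftrightarrow> \<turnstile> UMDE x y"
    by (rule occurrences_separate_UMDE) blast
  obtain c :: "'v \<Rightarrow> nat" where c: "\<And>x y. x \<in> D \<Longrightarrow> y \<in> D \<Longrightarrow> c x = c y \<longleftrightarrow> \<turnstile> UMI x y"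
    by (rule UMI_classes) blast
  obtain \<nu> :: "nat \<Rightarrow> 'a" where \<nu>: "inj \<nu>"
    using infinite_countable_subset[OF inf] by auto
  define n where "n = length Cs"
  \<comment> \<open>The positions of the bits that \<open>x\<close> reads.\<close>
  define H where "H x = {i. i < n \<and> x \<notin> Cs ! i}" for x
  have H_sub: "H x \<subseteq> {..<n}" and finH: "finite (H x)" for x by (auto simp: H_def)
  have card_H: "card (H x) = card (H y) \<longleftrightarrow> \<turnstile> UMDE x y" if "x \<in> D" "y \<in> D" for x y
  proof -
    have "card (H z) = n - occurrences Cs z" for z
    proof -
      have "H z = {..<n} - {i. i < n \<and> z \<in> Cs ! i}" by (auto simp: H_def)
      then show ?thesis
        by (simp add: occurrences_def length_filter_conv_card n_def card_Diff_subset subset_iff)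
    qed
    then have "card (H x) = card (H y) \<longleftrightarrow> occurrences Cs x = occurrences Cs y"
      using occurrences_le[of Cs x] occurrences_le[of Cs y] by (auto simp: n_def)
    then show ?thesis using occ that by simp
  qed
  \<comment> \<open>Bit patterns on \<open>H x\<close> are numbered from 0, so variables reading
    different bits but equally many of them can share the same value names.\<close>
  have "\<exists>e. bij_betw e (Pow (H x)) {0..<card (Pow (H x))}" for x
    using finH by (intro ex_bij_betw_finite_nat) simp
  then obtain e where e: "\<And>x. bij_betw (e x) (Pow (H x)) {0..<card (Pow (H x))}" by metis
  define B where "B = Pow {..<n}"
  \<comment> \<open>The UMI class is part of the value, so variables of different classes share no
    values.\<close>
  define val where "val x j = \<nu> (prod_encode (c x, j))" for x j
  have val_eq: "val x i = val y j \<longleftrightarrow> c x = c y \<and> i = j" for x y i j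
    using \<nu> by (auto simp: val_def inj_eq)
  define f where "f b = (\<lambda>x\<in>D. val x (e x (b \<inter> H x)))" for b
  define V where "V x = val x ` {..<2 ^ card (H x)}" for x
  define A where "A = (\<Union>x\<in>D. V x)"
  define X where "X = f ` B"
  \<comment> \<open>Some bits may be read by no variable, so \<open>f\<close> need not be injective;
    the weight counts the bit vectors behind an assignment.\<close>
  define W :: "('v \<Rightarrow> 'a) \<Rightarrow> 'k" where "W s = of_nat (card {b \<in> B. f b = s})" for s
  have finB: "finite B" by (simp add: B_def)
  have finV: "finite (V x)" for x by (simp add: V_def)
  have cardV: "card (V x) = 2 ^ card (H x)" for x
    unfolding V_def by (subst card_image) (auto simp: inj_on_def val_eq)
  have f_eq: "f b x = f b' x \<longleftrightarrow> b \<inter> H x = b' \<inter> H x" if "x \<in> D" for b b' x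
    using that bij_betw_imp_inj_on[OF e[of x]] by (auto simp: f_def val_eq inj_on_def)
  have e_less: "e x (b \<inter> H x) < 2 ^ card (H x)" for x b
    using bij_betwE[OF e[of x]] finH[of x] by (auto simp: card_Pow)
  have fV: "f b x \<in> V x" if "x \<in> D" for b x
    using that e_less[of x b] by (auto simp: f_def V_def)
  have VA: "V x \<subseteq> A" if "x \<in> D" for x using that by (auto simp: A_def)
  have over: "assignments_over D A X"
    unfolding assignments_over_def
  proof (intro conjI)
    show "finite A" using finite_D finV by (simp add: A_def)
    show "X \<subseteq> D \<rightarrow>\<^sub>E A"
      using fV VA unfolding X_def by (fastforce simp: PiE_iff f_def)
  qed (use finite_D finB in \<open>auto simp: X_def\<close>)
  have supp: "Supp X W = X"
    using finB inj_eq[OF inj, of _ 0] by (auto simp: Supp_def X_def W_def)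
  have fibre: "card {b \<in> B. f b x = v} = (if v \<in> V x then 2 ^ (n - card (H x)) else 0)"
    if x: "x \<in> D" for x v
  proof (cases "v \<in> V x")
    case True
    then obtain j where j: "v = val x j" "j < 2 ^ card (H x)" by (auto simp: V_def)
    then have "j \<in> {0..<card (Pow (H x))}" using finH[of x] by (simp add: card_Pow)
    then obtain T where T: "T \<subseteq> H x" "e x T = j"
      using e[of x] unfolding bij_betw_def by (metis (no_types, lifting) Pow_iff imageE)
    then have "v = f T x" using x j by (simp add: f_def Int_absorb2)
    then have "{b \<in> B. f b x = v} = {b \<in> B. b \<inter> H x = T}"
      using f_eq[OF x] T by (auto simp: Int_absorb2)
    \<comment> \<open>The bits in \<open>H x\<close> are fixed to \<open>T\<close>, and the other
      \<open>n - card (H x)\<close> bits are free.\<close>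
    also have "\<dots> = (\<lambda>b. T \<union> b) ` Pow ({..<n} - H x)"
    proof (intro equalityI subsetI)
      fix b assume "b \<in> {b \<in> B. b \<inter> H x = T}"
      then show "b \<in> (\<lambda>b. T \<union> b) ` Pow ({..<n} - H x)"
        by (intro image_eqI[of _ _ "b - H x"]) (auto simp: B_def)
    qed (use T H_sub[of x] in \<open>auto simp: B_def\<close>)
    also have "card \<dots> = card (Pow ({..<n} - H x))"
      using T by (intro card_image) (auto simp: inj_on_def)
    also have "\<dots> = 2 ^ (n - card (H x))"
      using finH H_sub by (simp add: card_Pow card_Diff_subset)
    finally show ?thesis using True by simp
  next
    case False
    then have "{b \<in> B. f b x = v} = {}" using fV[OF x] by auto
    then show ?thesis using False by (simp only: card.empty if_False)
  qed
  have marg: "marg X W [x] [v] = (if v \<in> V x then of_nat (2 ^ (n - card (H x))) else 0)"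
    if x: "x \<in> D" for x v
  proof -
    have "marg X W [x] [v] = of_nat (\<Sum>s\<in>{s \<in> X. s x = v}. card {b \<in> B. f b = s})"
      by (simp add: marg_def W_def)
    also have "(\<Sum>s\<in>{s \<in> X. s x = v}. card {b \<in> B. f b = s}) =
        card (\<Union>s\<in>{s \<in> X. s x = v}. {b \<in> B. f b = s})"
      using finB by (intro card_UN_disjoint[symmetric]) (auto simp: X_def)
    also have "(\<Union>s\<in>{s \<in> X. s x = v}. {b \<in> B. f b = s}) = {b \<in> B. f b x = v}"
      by (auto simp: X_def)
    finally show ?thesis using fibre[OF x] by (simp del: of_nat_power)
  qed
  have pow_neq_0: "of_nat (2 ^ k) \<noteq> (0 :: 'k)" for k
    using inj_eq[OF inj, of "2 ^ k" 0] by (simp del: of_nat_power)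
  have distr: "image_mset (marg X W [x]) (mset_set (marg_vals A X W [x])) =
      replicate_mset (2 ^ card (H x)) (of_nat (2 ^ (n - card (H x))))" if x: "x \<in> D" for x
  proof -
    have vals: "marg_vals A X W [x] = (\<lambda>v. [v]) ` V x"
      using VA[OF x] marg[OF x] pow_neq_0
      by (auto simp: marg_vals_def length_Suc_conv simp del: of_nat_power split: if_splits)
    have "image_mset (marg X W [x]) (mset_set (marg_vals A X W [x])) =
        image_mset (\<lambda>v. marg X W [x] [v]) (mset_set (V x))"
      unfolding vals by (subst image_mset_mset_set[symmetric])
        (auto simp: inj_on_def multiset.map_comp o_def)
    also have "\<dots> = image_mset (\<lambda>v. of_nat (2 ^ (n - card (H x)))) (mset_set (V x))"
      using marg[OF x] finV by (intro image_mset_cong) auto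
    finally show ?thesis using cardV by (simp add: image_mset_const_eq)
  qed
  have sat_UMDE: "sat A X W (UMDE x y) \<longleftrightarrow> \<turnstile> UMDE x y" if "x \<in> D" "y \<in> D" for x y
  proof -
    have "sat A X W (UMDE x y) \<longleftrightarrow> card (H x) = card (H y)"
    proof
      assume "sat A X W (UMDE x y)"
      \<comment> \<open>Sizes suffice: the exponent is recovered from the number of entries.\<close>
      then have "size (replicate_mset (2 ^ card (H x)) (of_nat (2 ^ (n - card (H x))) :: 'k)) =
          size (replicate_mset (2 ^ card (H y)) (of_nat (2 ^ (n - card (H y))) :: 'k))"
        using distr that by (simp del: of_nat_power size_replicate_mset)
      then show "card (H x) = card (H y)" by simp
    qed (use distr that in simp)
    then show ?thesis using card_H that by simp
  qed
  have sat_UMI: "sat A X W (UMI x y) \<longleftrightarrow> \<turnstile> UMI x y" if D: "x \<in> D" "y \<in> D" for x y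
  proof
    assume "\<turnstile> UMI x y"
    then have "c x = c y" "card (H x) = card (H y)"
      using c card_H UMDE_of_UMI D by auto
    moreover then have "V x = V y" by (auto simp: V_def val_def)
    ultimately show "sat A X W (UMI x y)" using marg D by simp
  next
    assume sat: "sat A X W (UMI x y)"
    \<comment> \<open>The number 0 always names a value, even if \<open>x\<close> reads no bit;
      finding it in \<open>V y\<close> forces equal classes.\<close>
    have v: "val x 0 \<in> V x" by (auto simp: V_def)
    then have "marg X W [y] [val x 0] = marg X W [x] [val x 0]"
      using sat VA[OF D(1)] by auto
    also have "\<dots> \<noteq> 0" using marg[OF D(1)] v pow_neq_0 by (simp del: of_nat_power)
    finally have "val x 0 \<in> V y" using marg[OF D(2), of "val x 0"] by (metis (full_types))
    then have "c x = c y" by (auto simp: V_def val_eq)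
    then show "\<turnstile> UMI x y" using c D by simp
  qed
  have sat_FD: "sat A X W (FD xs ys)" if fd: "\<turnstile> FD xs ys" for xs ys
  proof -
    have D: "set xs \<subseteq> D" "set ys \<subseteq> D" using FD_over[OF fd] by auto
    have "f b y = f b' y" if eq: "\<forall>x\<in>set xs. f b x = f b' x" and y: "y \<in> set ys" for b b' y
    proof -
      \<comment> \<open>If \<open>y\<close> lies outside the closed set \<open>Cs ! i\<close>, so
        does some variable of \<open>xs\<close>, which thus reads bit \<open>i\<close> as
        well.\<close>
      have "i \<in> b \<longleftrightarrow> i \<in> b'" if "i \<in> H y" for i
      proof -
        have "i < n" "y \<notin> Cs ! i" using that by (auto simp: H_def)
        then have "\<not> set xs \<subseteq> Cs ! i"
          using Cs(2)[of "Cs ! i"] fd y by (auto simp: fd_closed_def n_def)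
        then obtain x where "x \<in> set xs" "i \<in> H x" using \<open>i < n\<close> by (auto simp: H_def)
        then show ?thesis using eq f_eq[of x b b'] D by blast
      qed
      then show ?thesis using f_eq[of y b b'] D y by blast
    qed
    then show ?thesis by (auto simp: supp) (auto simp: X_def)
  qed
  have "sat A X W \<sigma>" if "\<sigma> \<in> \<Sigma>" for \<sigma>
  proof -
    have "\<turnstile> \<sigma>" using that by (rule derivable_premise)
    then show ?thesis using sat_FD sat_UMI sat_UMDE UMI_over UMDE_over by (cases \<sigma>) blast+
  qed
  moreover have "\<not> sat A X W \<tau>"
  proof (cases \<tau>)
    case (FD xs ys)
    then have D: "set xs \<subseteq> D" "set ys \<subseteq> D" using \<tau>(1) by (auto simp: atoms_over_def)
    obtain i where i: "i < n" "Cs ! i = fd_closure xs"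
      using Cs(1) FD by (auto simp: C0_def n_def in_set_conv_nth)
    obtain y where y: "y \<in> set ys" "y \<notin> fd_closure xs"
      using \<tau>(2) FD FD_iff_closure[OF D(1)] by auto
    have xs: "set xs \<subseteq> fd_closure xs"
      using FD_iff_closure[OF D(1), of xs] FD_refl[OF subset_refl D(1)] by simp
    \<comment> \<open>The two bit vectors differ only in bit \<open>i\<close>, which belongs to
      \<open>fd_closure xs\<close>: all of \<open>xs\<close> ignore it, but \<open>y\<close> reads
      it.\<close>
    have "f {} x = f {i} x" if "x \<in> set xs" for x
      using that D i xs f_eq[of x "{}" "{i}"] by (auto simp: H_def)
    moreover have "f {} y \<noteq> f {i} y"
      using y D i f_eq[of y "{}" "{i}"] by (auto simp: H_def)
    moreover have "f {} \<in> Supp X W" "f {i} \<in> Supp X W"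
      using i unfolding supp by (auto simp: X_def B_def)
    ultimately show ?thesis using y(1) FD by auto
  next
    case (UMI x y)
    then show ?thesis using sat_UMI \<tau>
      by (auto simp: atoms_over_def simp del: sat.simps)
  next
    case (UMDE x y)
    then show ?thesis using sat_UMDE \<tau>
      by (auto simp: atoms_over_def simp del: sat.simps)
  qed
  ultimately show ?thesis using over by blast
qed

end

text \<open>Positivity and \<open>1 \<noteq> 0\<close> keep successors away from 0; cancellation
  removes a common summand 1 in the induction.\<close>

lemma inj_of_nat_positive_cancellative:
  assumes positive_add: "\<And>a b :: 'k::semiring_1. a + b = 0 \<Longrightarrow> a = 0 \<and> b = 0"
    and cancellative: "\<And>a b c :: 'k. a + b = a + c \<Longrightarrow> b = c"
  shows "inj (of_nat :: nat \<Rightarrow> 'k)"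
proof (rule injI)
  have nz: "of_nat (Suc m) \<noteq> (0 :: 'k)" for m
    using positive_add[of 1 "of_nat m"] by auto
  show "m = m'" if "of_nat m = (of_nat m' :: 'k)" for m m'
    using that
  proof (induction m arbitrary: m')
    case 0
    then show ?case using nz by (cases m') (metis of_nat_0)+
  next
    case (Suc m)
    then obtain l where "m' = Suc l" using nz by (cases m') (metis of_nat_0)+
    then show ?case using Suc cancellative[of 1 "of_nat m" "of_nat l"] by simp
  qed
qed

theorem theorem3:
  fixes D :: "'v set" and \<Sigma> :: "'v atom set" and \<tau> :: "'v atom"
  assumes positive_add: "\<And>a b :: 'k::semiring_1. a + b = 0 \<Longrightarrow> a = 0 \<and> b = 0"
    and positive_mult: "\<And>a b :: 'k. a * b = 0 \<Longrightarrow> a = 0 \<or> b = 0"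
    and cancellative: "\<And>a b c :: 'k. a + b = a + c \<Longrightarrow> b = c"
    and infinite_values: "infinite (UNIV :: 'a set)"
    and "finite D" and "finite \<Sigma>" and "\<Sigma> \<union> {\<tau>} \<subseteq> atoms_over D"
  shows "derives D A_FD_UMI_UMDE \<Sigma> \<tau> \<longleftrightarrow> entails TYPE('a) TYPE('k) D \<Sigma> \<tau>"
proof
  assume "derives D A_FD_UMI_UMDE \<Sigma> \<tau>"
  then show "entails TYPE('a) TYPE('k) D \<Sigma> \<tau>"
    using derives_sound[OF positive_add] assms(7) by blast
next
  interpret dependencies D \<Sigma>
    using assms(5,7) by unfold_locales auto
  assume entails: "entails TYPE('a) TYPE('k) D \<Sigma> \<tau>"
  have inj: "inj (of_nat :: nat \<Rightarrow> 'k)"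
    by (rule inj_of_nat_positive_cancellative[OF positive_add cancellative])
  show "derives D A_FD_UMI_UMDE \<Sigma> \<tau>"
  proof (rule ccontr)
    assume "\<not> derives D A_FD_UMI_UMDE \<Sigma> \<tau>"
    with countermodel[OF inj infinite_values, of \<tau>] assms(7)
    obtain A :: "'a set" and X and W :: "('v \<Rightarrow> 'a) \<Rightarrow> 'k"
      where "assignments_over D A X" "\<forall>\<sigma>\<in>\<Sigma>. sat A X W \<sigma>" "\<not> sat A X W \<tau>"
      by auto
    with entails show False unfolding entails_def by blast
  qed
qed

end
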